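(* For every integer $n\ge 0$: $\tilde e(n,1,0)=S_{-1}(\tilde e(n,0,0))$; $\tilde e(n,-1,0)=\tilde e(n,1,0)$; and $\tilde e(n,0,0)=\tilde h(M_{n,0})$ for some finite multiset $M_{n,0}\in R(2^{n+1})$. Furthermore, $\tilde e(n+1,0,0)=L(\tilde e(n,0,0))\,\tilde h(M_{n,0}+M_{n,0})$ (left action of $\mathrm{CH}_2$).
   Context: Let $\mathrm{CH}_2$ be the commutative ring which is a free $\mathbb{Z}$-module with basis $\{h_i : i\ge 0\}$ and multiplication $h_ih_j=\sum_{k=0}^{\min(i,j)}h_{i+j-2k}$. Let $\tilde{\mathrm{CH}}_2$ be the free $\mathbb{Z}$-module with basis $\{\tilde h_i : i\in\mathbb{Z}\}$, with left $\mathrm{CH}_2$-action $h_i\tilde h_j=\sum_{k=0}^{i}\tilde h_{j-i+2k}$ ($i\ge0$), extended bilinearly. Let $L:\tilde{\mathrm{CH}}_2\to \mathrm{CH}_2$ be the $\mathbb{Z}$-linear map with $L(\tilde h_{-1})=0$, $L(\tilde h_i)=h_i$ for $i\ge 0$, $L(\tilde h_i)=-h_{-i-2}$ for $i\le -2$. The (associative, non-commutative) product on $\tilde{\mathrm{CH}}_2$ is $g_1g_2:=L(g_1)\,g_2$; powers $g^2=gg$. For $i\in\mathbb{Z}$, $S_i$ is the $\mathbb{Z}$-linear map with $S_i(\tilde h_j)=\tilde h_{j+i}$. Multisets: all multisets are finite multisets of integers; $\mathrm{mult}(i,M)$ is the multiplicity of $i$ in $M$; $\tilde h(M)=\sum_{i}\mathrm{mult}(i,M)\tilde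 h_i$. The sum $M_1+M_2$ is the multiset $\{i_1+i_2: i_1\in M_1,i_2\in M_2\}$ counted with multiplicity, i.e. $\mathrm{mult}(i,M_1+M_2)=\sum_k\mathrm{mult}(i-k,M_1)\mathrm{mult}(k,M_2)$; $\cup$ denotes multiset union (multiplicities add). For integers $a\le b$ with $a\equiv b\pmod 2$, $[a,b]=\{a,a+2,\dots,b\}$. For an integer $c$, $R(c)$ is the set of multisets of the form $\bigcup_{i=1}^{k_1}\{m_i\}\cup\bigcup_{i=1}^{k_2}[c-n_i,c+n_i]$ with integers $k_1,k_2\ge 0$, $m_i\ge c$, $n_i\ge 1$. Define $\tilde e(n,i,0)\in\tilde{\mathrm{CH}}_2$ ($n\ge0$, $i\in\{-1,0,1\}$) by $\tilde e(0,0,0)=\tilde h_2$, $\tilde e(0,1,0)=\tilde e(0,-1,0)=\tilde h_1$, and for $n\ge0$: $\tilde e(n+1,0,0)=\tilde e(n,0,0)\big(\tilde e(n,0,0)^2-\tilde e(n,1,0)^2\big)$, $\tilde e(n+1,1,0)=\tilde e(n,1,0)\tilde e(n,0,0)\tilde e(n,0,0)+\tilde e(n,0,0)\tilde e(n,0,0)\tilde e(n,1,0)-\tilde e(n,1,0)\tilde h_1\tilde e(n,0,0)\tilde e(n,1,0)$, $\tilde e(n+1,-1,0)=\tilde e(n,1,0)\tilde e(n,0,0)\tilde e(n,0,0)+\tilde e(n,0,0)\tilde e(n,0,0)\tilde e(n,1,0)-\tilde e(n,1,0)\tilde h_1\tilde e(n,0,0)\tilde e(n,1,0)+\tilde e(n,-1,0)^2\big(\tilde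 e(n,-1,0)-\tilde e(n,1,0)\big)$. *)

theory Defs
  imports "HOL-Library.Poly_Mapping" "HOL-Library.Multiset"
begin

text \<open>
  The free \<open>\<int>\<close>-module on a set of indices is the type of finitely supported integer-valued
  functions, with basis \<^const>\<open>frag_of\<close> and linear extension \<^const>\<open>frag_extend\<close>.
  The convolution product that the library puts on this type is neither the product of
  \<open>CH\<^sub>2\<close> nor that of \<open>CH\<^sub>2~\<close>; these have their own symbols below.
\<close>

type_synonym CH2 = "nat \<Rightarrow>\<^sub>0 int"
type_synonym CH2t = "int \<Rightarrow>\<^sub>0 int"

abbreviation h :: "nat \<Rightarrow> CH2" where "h i \<equiv> frag_of i"
abbreviation ht :: "int \<Rightarrow> CH2t" where "ht i \<equiv> frag_of i"

definition ch_mult :: "CH2 \<Rightarrow> CH2 \<Rightarrow> CH2"  (infixl \<open>\<otimes>\<close> 70) where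
  "f \<otimes> g = frag_extend (\<lambda>i. frag_extend (\<lambda>j. \<Sum>k=0..min i j. h (i + j - 2 * k)) g) f"

definition ch_act :: "CH2 \<Rightarrow> CH2t \<Rightarrow> CH2t"  (infixr \<open>\<odot>\<close> 75) where
  "f \<odot> g = frag_extend (\<lambda>i. frag_extend (\<lambda>j. \<Sum>k=0..i. ht (j - int i + 2 * int k)) g) f"

definition L :: "CH2t \<Rightarrow> CH2" where
  "L = frag_extend (\<lambda>i. if i = -1 then 0 else if i \<ge> 0 then h (nat i) else - h (nat (- i - 2)))"

definition cht_mult :: "CH2t \<Rightarrow> CH2t \<Rightarrow> CH2t"  (infixl \<open>\<star>\<close> 70) where
  "g\<^sub>1 \<star> g\<^sub>2 = L g\<^sub>1 \<odot> g\<^sub>2"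

definition S :: "int \<Rightarrow> CH2t \<Rightarrow> CH2t" where
  "S i = frag_extend (\<lambda>j. ht (j + i))"

definition ht_mset :: "int multiset \<Rightarrow> CH2t" where
  "ht_mset M = (\<Sum>i\<in>set_mset M. frag_cmul (int (count M i)) (ht i))"

text \<open>The library's \<open>+\<close> on multisets is the union; this is the sum of the elements.\<close>

definition mset_sum :: "int multiset \<Rightarrow> int multiset \<Rightarrow> int multiset"  (infixl \<open>\<oplus>\<close> 65) where
  "M\<^sub>1 \<oplus> M\<^sub>2 = (\<Sum>i\<^sub>1\<in>#M\<^sub>1. {# i\<^sub>1 + i\<^sub>2. i\<^sub>2 \<in># M\<^sub>2 #})"

definition step2 :: "int \<Rightarrow> int \<Rightarrow> int multiset" where
  "step2 a b = mset_set {i. a \<le> i \<and> i \<le> b \<and> even (i - a)}"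

definition R :: "int \<Rightarrow> int multiset set" where
  "R c = {(\<Sum>i=1..k\<^sub>1. {# m i #}) + (\<Sum>i=1..k\<^sub>2. step2 (c - n i) (c + n i)) |
            (k\<^sub>1 :: nat) (k\<^sub>2 :: nat) (m :: nat \<Rightarrow> int) (n :: nat \<Rightarrow> int).
            (\<forall>i\<in>{1..k\<^sub>1}. m i \<ge> c) \<and> (\<forall>i\<in>{1..k\<^sub>2}. n i \<ge> 1)}"

text \<open>\<open>e0 n\<close>, \<open>e1 n\<close>, \<open>em1 n\<close> are \<open>e~(n,0,0)\<close>, \<open>e~(n,1,0)\<close>, \<open>e~(n,-1,0)\<close>.\<close>

fun e0 e1 em1 :: "nat \<Rightarrow> CH2t" where
  "e0 0 = ht 2"
| "e1 0 = ht 1"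
| "em1 0 = ht 1"
| "e0 (Suc n) = e0 n \<star> (e0 n \<star> e0 n - e1 n \<star> e1 n)"
| "e1 (Suc n) = e1 n \<star> e0 n \<star> e0 n + e0 n \<star> e0 n \<star> e1 n - e1 n \<star> ht 1 \<star> e0 n \<star> e1 n"
| "em1 (Suc n) = e1 n \<star> e0 n \<star> e0 n + e0 n \<star> e0 n \<star> e1 n - e1 n \<star> ht 1 \<star> e0 n \<star> e1 n
                 + em1 n \<star> em1 n \<star> (em1 n - e1 n)"

lemma count_mset_sum:
  "count (M \<oplus> N) i = (\<Sum>k\<in>set_mset N. count M (i - k) * count N k)"
proof (induction M)
  case empty
  show ?case by (simp add: mset_sum_def)
next
  case (add x M)
  have "count (image_mset ((+) x) N) i = count N (i - x)"
    by (induction N) auto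
  also have "\<dots> = (\<Sum>k\<in>set_mset N. if k = i - x then count N k else 0)"
    by (simp add: not_in_iff)
  finally have "count (add_mset x M \<oplus> N) i =
      (\<Sum>k\<in>set_mset N. if k = i - x then count N k else 0)
        + (\<Sum>k\<in>set_mset N. count M (i - k) * count N k)"
    using add by (simp add: mset_sum_def)
  also have "\<dots> = (\<Sum>k\<in>set_mset N. count (add_mset x M) (i - k) * count N k)"
    by (subst sum.distrib [symmetric], rule sum.cong) auto
  finally show ?case .
qed

subsection \<open>Associativity of the products\<close>

text \<open>
  The action of \<open>CH\<^sub>2\<close> is the convolution product with the symmetric Laurent polynomial
  obtained by replacing \<open>h\<^sub>i\<close> by \<open>x\<^sup>-\<^sup>i + x\<^sup>2\<^sup>-\<^sup>i + \<dots> + x\<^sup>i\<close>.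
\<close>

definition char_h :: "nat \<Rightarrow> CH2t" where
  "char_h i = (\<Sum>k=0..i. ht (2 * int k - int i))"

lemma frag_cmul_conv_times: "frag_cmul c x = Poly_Mapping.single 0 c * (x :: CH2t)"
  by (rule poly_mapping_eqI) (simp flip: mult_map_scale_conv_mult add: map.rep_eq when_def)

lemma frag_extend_times:
  fixes y :: CH2t
  shows "frag_extend f x * y = frag_extend (\<lambda>i. f i * y) x"
    and "y * frag_extend f x = frag_extend (\<lambda>i. y * f i) x"
  by (simp_all add: frag_extend_def sum_distrib_left sum_distrib_right frag_cmul_conv_times mult_ac)

lemma frag_extend_frag_extend:
  "frag_extend f (frag_extend g x) = frag_extend (\<lambda>i. frag_extend f (g i)) x"
  unfolding frag_extend_def [of g] frag_extend_def [of _ x]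
  by (simp add: frag_extend_sum frag_extend_cmul)

lemma ch_act_conv_times: "f \<odot> g = frag_extend char_h f * g"
proof -
  have "(\<Sum>k=0..i. ht (j - int i + 2 * int k)) = char_h i * ht j" for i j
    unfolding char_h_def sum_distrib_right by (rule sum.cong) (simp_all add: mult_single algebra_simps)
  then have "f \<odot> g = frag_extend (\<lambda>i. char_h i * frag_extend frag_of g) f"
    by (simp add: ch_act_def frag_extend_times)
  then show ?thesis
    by (simp add: frag_extend_times flip: frag_expansion)
qed

abbreviation D :: CH2t where "D \<equiv> ht 1 - ht (- 1)"

lemma D_char_h: "D * char_h i = ht (int i + 1) - ht (- int i - 1)"
proof -
  have "D * char_h i = (\<Sum>k=0..i. ht (2 * int (Suc k) - int i - 1) - ht (2 * int k - int i - 1))"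
    by (simp add: char_h_def sum_distrib_left left_diff_distrib mult_single algebra_simps)
  also have "\<dots> = (\<Sum>k<Suc i. ht (2 * int (Suc k) - int i - 1) - ht (2 * int k - int i - 1))"
    by (rule sum.cong) auto
  also have "\<dots> = ht (int i + 1) - ht (- int i - 1)"
    by (subst sum_lessThan_telescope) (simp add: algebra_simps)
  finally show ?thesis .
qed

abbreviation flip :: "CH2t \<Rightarrow> CH2t" where "flip \<equiv> frag_extend (\<lambda>j. ht (- j))"

lemma D_char_L: "D * frag_extend char_h (L g) = ht 1 * g - ht (- 1) * flip g"
proof -
  have *: "D * frag_extend char_h (if i = -1 then 0 else if i \<ge> 0 then h (nat i) else - h (nat (- i - 2)))
     = ht (i + 1) - ht (- i - 1)" for i :: int
  proof -
    have "- 1 - i = - i - 1"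
      by simp
    from arg_cong [OF this, of frag_of] show ?thesis
      by (simp add: D_char_h frag_extend_minus add.commute)
  qed
  have "D * frag_extend char_h (L g) = frag_extend (\<lambda>i. ht (i + 1) - ht (- i - 1)) g"
    by (simp only: L_def frag_extend_frag_extend frag_extend_times(2)
          * [unfolded frag_extend_times(2)])
  also have "\<dots> = frag_extend (\<lambda>i. ht (i + 1)) g - frag_extend (\<lambda>i. ht (- i - 1)) g"
    by (simp add: frag_extend_def sum_subtractf frag_cmul_conv_times right_diff_distrib)
  also have "frag_extend (\<lambda>i. ht (i + 1)) g = ht 1 * frag_extend frag_of g"
    by (simp only: frag_extend_times) (simp add: mult_single add.commute)
  also have "frag_extend (\<lambda>i. ht (- i - 1)) g = ht (- 1) * flip g"
    by (simp only: frag_extend_times) (simp add: mult_single algebra_simps)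
  finally show ?thesis
    by (simp flip: frag_expansion)
qed

lemma flip_times: "flip (x * y) = flip x * flip y"
proof -
  have "flip (frag_extend frag_of x * frag_extend frag_of y) = flip x * flip y"
    by (simp add: frag_extend_times frag_extend_frag_extend mult_single)
  then show ?thesis
    by (simp flip: frag_expansion)
qed

lemma flip_char: "flip (frag_extend char_h f) = frag_extend char_h f"
proof -
  have "flip (char_h i) = char_h i" for i
    unfolding char_h_def
    by (subst sum.atLeastAtMost_rev) (simp add: frag_extend_sum o_def of_nat_diff algebra_simps)
  then show ?thesis
    by (simp add: frag_extend_frag_extend)
qed

lemma D_neq_0: "D \<noteq> 0"
  by (metis eq_iff_diff_eq_0 frag_of_eq one_neq_neg_one)

lemma char_L_act: "frag_extend char_h (L (f \<odot> g)) = frag_extend char_h f * frag_extend char_h (L g)"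
proof -
  have "D * frag_extend char_h (L (f \<odot> g)) = D * (frag_extend char_h f * frag_extend char_h (L g))"
    unfolding D_char_L mult.left_commute [of D]
    by (simp add: ch_act_conv_times flip_times flip_char algebra_simps)
  then show ?thesis
    using D_neq_0 by simp
qed

lemma cht_mult_assoc: "(x \<star> y) \<star> z = x \<star> (y \<star> z)"
  by (simp add: cht_mult_def char_L_act ch_act_conv_times [of _ z] mult.assoc)
     (simp add: ch_act_conv_times)

lemma ch_mult_act: "(f \<otimes> g) \<odot> x = f \<odot> g \<odot> x"
proof -
  have *: "(\<Sum>k=0..min i j. char_h (i + j - 2 * k)) = char_h i * char_h j" for i j
  proof -
    have **: "(\<Sum>k=0..j. char_h (i + j - 2 * k)) = char_h i * char_h j" if "j \<le> i" for i j
    proof -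
      have "D * char_h (i + j - 2 * k) = ht (int i + 1) * ht (int j - 2 * int k) - ht (- int i - 1) * ht (2 * int k - int j)"
        if "k \<in> {0..j}" for k
        unfolding D_char_h using that \<open>j \<le> i\<close>
        by (simp add: mult_single of_nat_diff algebra_simps)
      then have "D * (\<Sum>k=0..j. char_h (i + j - 2 * k))
          = ht (int i + 1) * (\<Sum>k=0..j. ht (int j - 2 * int k)) - ht (- int i - 1) * char_h j"
        by (simp add: sum_distrib_left sum_subtractf char_h_def)
      also have "(\<Sum>k=0..j. ht (int j - 2 * int k)) = char_h j"
        unfolding char_h_def
        by (subst sum.atLeastAtMost_rev) (simp add: of_nat_diff algebra_simps)
      finally have "D * (\<Sum>k=0..j. char_h (i + j - 2 * k)) = D * (char_h i * char_h j)"
        unfolding mult.assoc [symmetric] D_char_h by (simp add: left_diff_distrib)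
      then show ?thesis
        using D_neq_0 by simp
    qed
    show ?thesis
      using ** [of i j] ** [of j i]
      by (cases "j \<le> i") (simp_all add: min_def add.commute mult.commute)
  qed
  have "frag_extend char_h (f \<otimes> g) = frag_extend char_h f * frag_extend char_h g"
    by (simp only: ch_mult_def frag_extend_times(1) frag_extend_frag_extend)
       (simp add: frag_extend_sum o_def * frag_extend_times(2))
  then show ?thesis
    by (simp add: ch_act_conv_times mult.assoc)
qed

end

theory Submission
  imports Defs
begin

text \<open>
  Regard \<open>CH\<^sub>2~\<close> as the ring of Laurent polynomials in \<open>x\<close>, with \<open>x\<^sup>i\<close> for the \<open>i\<close>-th basis element.
  The product is then \<open>P \<star> Q = \<chi>(P) Q\<close>, where \<open>\<chi>(P) = (x P(x) - x\<^sup>-\<^sup>1 P(x\<^sup>-\<^sup>1)) / (x - x\<^sup>-\<^sup>1)\<close> is the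
  Weyl character formula for \<open>SL\<^sub>2\<close>. For \<open>Q = x\<^sup>-\<^sup>1 P\<close> it yields \<open>\<chi>(P) - x\<^sup>-\<^sup>1 \<chi>(Q) = P\<close>, and with it
  the recursions collapse to \<open>P \<mapsto> \<chi>(P) P\<^sup>2\<close> and \<open>Q \<mapsto> x\<^sup>-\<^sup>1 \<chi>(P) P\<^sup>2\<close>.

  The multisets in \<open>R(c)\<close> correspond to \<open>x\<^sup>c K\<close>, where \<open>K\<close> is the set of sums of monomials
  \<open>x\<^sup>d\<close> with \<open>d \<ge> 0\<close> and of irreducible characters. Since \<open>K\<close> is closed under multiplication (by the
  Clebsch-Gordan rule) and contains \<open>\<chi>(x\<^sup>c f)\<close> for \<open>c \<ge> 0\<close> and \<open>f \<in> K\<close>, the recursion takes \<open>x\<^sup>c K\<close>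
  to \<open>x\<^sup>2\<^sup>c K\<close>.
\<close>

section \<open>Multisets as Laurent polynomials\<close>

lemma lookup_ht_mset: "poly_mapping.lookup (ht_mset M) i = int (count M i)"
proof -
  have "poly_mapping.lookup (ht_mset M) i = (\<Sum>j\<in>set_mset M. if j = i then int (count M j) else 0)"
    unfolding ht_mset_def lookup_sum
    by (rule sum.cong) (auto simp: lookup_single)
  also have "\<dots> = int (count M i)"
    by (simp add: not_in_iff)
  finally show ?thesis .
qed

lemma ht_mset_empty [simp]: "ht_mset {#} = 0"
  by (simp add: ht_mset_def)

lemma ht_mset_union [simp]: "ht_mset (M + N) = ht_mset M + ht_mset N"
  by (rule poly_mapping_eqI) (simp add: lookup_ht_mset lookup_add)

lemma ht_mset_single [simp]: "ht_mset {#i#} = ht i"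
  by (simp add: ht_mset_def)

lemma ht_mset_add_mset [simp]: "ht_mset (add_mset i M) = ht i + ht_mset M"
  using ht_mset_union [of "{#i#}" M] by simp

lemma ht_mset_translate: "ht_mset (image_mset ((+) i) M) = ht i * ht_mset M"
  by (induction M) (simp_all add: mult_single algebra_simps)

lemma ht_mset_mset_sum: "ht_mset (M \<oplus> N) = ht_mset M * ht_mset N"
  by (induction M) (simp_all add: mset_sum_def ht_mset_translate algebra_simps)

lemma ht_mset_mset_set: "finite A \<Longrightarrow> ht_mset (mset_set A) = (\<Sum>i\<in>A. ht i)"
  by (induction A rule: finite_induct) simp_all

text \<open>The exponents of \<open>char_h n\<close> are the weights -n, -n + 2, ..., n, so the
  interval is this weight set translated by \<open>c\<close>.\<close>

lemma ht_mset_step2: "ht_mset (step2 (c - int n) (c + int n)) = ht c * char_h n"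
proof -
  let ?A = "{i. c - int n \<le> i \<and> i \<le> c + int n \<and> even (i - (c - int n))}"
  have bij: "bij_betw (\<lambda>k. c + (2 * int k - int n)) {0..n} ?A"
  proof (rule bij_betw_byWitness [where f' = "\<lambda>i. nat ((i - (c - int n)) div 2)"])
    show "(\<lambda>i. nat ((i - (c - int n)) div 2)) ` ?A \<subseteq> {0..n}"
      by auto
  qed auto
  then have "finite ?A"
    using bij_betw_finite by blast
  then have "ht_mset (step2 (c - int n) (c + int n)) = (\<Sum>i\<in>?A. ht i)"
    by (simp add: step2_def ht_mset_mset_set)
  also have "\<dots> = (\<Sum>k=0..n. ht (c + (2 * int k - int n)))"
    by (rule sum.reindex_bij_betw [OF bij, symmetric])
  also have "\<dots> = ht c * char_h n"
    by (simp add: char_h_def sum_distrib_left mult_single)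
  finally show ?thesis .
qed

lemma S_conv_times: "S i f = ht i * f"
proof -
  have "S i f = ht i * frag_extend frag_of f"
    by (simp only: frag_extend_times) (simp add: S_def mult_single add.commute)
  then show ?thesis
    by (simp flip: frag_expansion)
qed

section \<open>The recursion\<close>

abbreviation char_L :: "CH2t \<Rightarrow> CH2t" where "char_L g \<equiv> frag_extend char_h (L g)"

lemma cht_mult_conv_times: "f \<star> g = char_L f * g"
  by (simp add: cht_mult_def ch_act_conv_times)

text \<open>This is \<open>char_L_act\<close> for \<open>L f\<close>; it lets characters be pulled
  out of \<open>char_L\<close>.\<close>

lemma char_L_times: "char_L (char_L f * g) = char_L f * char_L g"
  using char_L_act [of "L f" g] by (simp add: ch_act_conv_times)

lemma char_L_ht_1: "char_L (ht 1) = ht 1 + ht (- 1)"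
  by (simp add: L_def char_h_def)

text \<open>Multiplied by \<open>D\<close>, both sides become
  \<open>ht 1 * P - ht (- 1) * flip P\<close>, and \<open>D\<close> can be cancelled.\<close>

lemma char_L_shift: "char_L P = ht (- 1) * char_L (ht (- 1) * P) + P"
proof -
  have 1: "ht 1 * (ht (- 1) * f) = f" "ht (- 1) * (ht 1 * f) = f" for f
    by (simp_all add: mult_single flip: mult.assoc)
  have "D * char_L (ht (- 1) * P) = P - flip P"
    unfolding D_char_L flip_times by (simp add: 1)
  then have "D * (ht (- 1) * char_L (ht (- 1) * P) + P) = ht (- 1) * (P - flip P) + D * P"
    by (simp add: distrib_left mult.left_commute [of D])
  also have "\<dots> = D * char_L P"
    unfolding D_char_L by (simp add: algebra_simps)
  finally show ?thesis
    using D_neq_0 by simp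
qed

lemma e_Suc:
  assumes e1: "e1 n = ht (- 1) * e0 n" and em1: "em1 n = e1 n"
  shows "e0 (Suc n) = char_L (e0 n) * (e0 n * e0 n)"
    and "e1 (Suc n) = ht (- 1) * e0 (Suc n)"
    and "em1 (Suc n) = e1 (Suc n)"
proof -
  define P A B y where "P = e0 n" and "A = char_L P" and "B = char_L (ht (- 1) * P)" and "y = ht (- 1)"
  have A: "A = y * B + P"
    unfolding A_def B_def y_def by (rule char_L_shift)
  have xy: "ht 1 * y = 1"
    by (simp add: y_def mult_single)
  have "e0 (Suc n) = A * (A * P - B * (y * P))"
    by (simp add: e1 cht_mult_conv_times A_def B_def P_def y_def)
  also have "\<dots> = A * (P * P)"
    unfolding A by (simp add: algebra_simps)
  finally have *: "e0 (Suc n) = A * (P * P)" .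
  then show "e0 (Suc n) = char_L (e0 n) * (e0 n * e0 n)"
    by (simp add: A_def P_def)
  have "e1 (Suc n) = B * A * P + A * A * (y * P) - B * (ht 1 + y) * A * (y * P)"
    \<comment> \<open>Nesting to the right makes each left factor act through its own character,
      with \<open>ht 1\<close> contributing \<open>ht 1 + y\<close>.\<close>
    unfolding e1.simps cht_mult_assoc
    by (simp add: e1 cht_mult_conv_times char_L_ht_1 A_def B_def P_def y_def mult.assoc)
  also have "\<dots> = B * A * P + A * A * (y * P) - (ht 1 * y) * (B * A * P) - y * y * B * A * P"
    by (simp add: algebra_simps)
  \<comment> \<open>Since \<open>ht 1 * y = 1\<close>, the third summand cancels the first.\<close>
  also have "\<dots> = y * A * P * (A - y * B)"
    unfolding xy by (simp add: algebra_simps)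
  also have "A - y * B = P"
    by (simp add: A)
  finally show "e1 (Suc n) = ht (- 1) * e0 (Suc n)"
    unfolding * by (simp add: y_def mult.assoc)
  show "em1 (Suc n) = e1 (Suc n)"
    by (simp add: em1 cht_mult_conv_times)
qed

section \<open>The semiring spanned by monomials and characters\<close>

inductive_set K :: "CH2t set" where
  zero: "0 \<in> K"
| add_ht: "f \<in> K \<Longrightarrow> ht (int d) + f \<in> K"
| add_char: "f \<in> K \<Longrightarrow> char_h n + f \<in> K"

lemma K_add: "f \<in> K \<Longrightarrow> g \<in> K \<Longrightarrow> f + g \<in> K"
  by (induction rule: K.induct) (auto simp: add.assoc intro: K.intros)

lemma K_sum: "(\<And>i. i \<in> A \<Longrightarrow> f i \<in> K) \<Longrightarrow> sum f A \<in> K"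
  by (induction A rule: infinite_finite_induct) (auto intro: K.zero K_add)

lemma ht_in_K: "ht (int d) \<in> K"
  using K.add_ht [OF K.zero] by simp

lemma char_h_in_K: "char_h n \<in> K"
  using K.add_char [OF K.zero] by simp

lemma char_h_0: "char_h 0 = ht 0"
  by (simp add: char_h_def)

lemma ht_1_char_h_Suc: "ht 1 * char_h (Suc n) = ht (int n + 2) + char_h n"
  by (simp add: char_h_def sum_distrib_left mult_single distrib_left algebra_simps)

text \<open>Each factor \<open>ht 1\<close> splits off the top monomial and lowers the index of the
  character by one; at index 0 only a monomial is left.\<close>

lemma ht_char_h_in_K: "ht (int d) * char_h n \<in> K"
proof (induction d arbitrary: n)
  case 0
  show ?case by (simp add: char_h_in_K)
next
  case (Suc d)
  show ?case
  proof (cases n)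
    case 0
    then show ?thesis
      using ht_in_K [of "Suc d"] by (simp add: char_h_0)
  next
    case (Suc m)
    have "ht (int (Suc d)) * char_h n = ht (int d) * (ht 1 * char_h (Suc m))"
      by (simp add: Suc mult_single add.commute flip: mult.assoc)
    also have "\<dots> = ht (int (d + m + 2)) + ht (int d) * char_h m"
      unfolding ht_1_char_h_Suc by (simp add: distrib_left mult_single algebra_simps)
    finally show ?thesis
      using K.add_ht [OF Suc.IH, of "d + m + 2"] by simp
  qed
qed

text \<open>The Clebsch-Gordan rule follows by letting both sides of \<open>ch_mult_act\<close> act
  on \<open>ht 0\<close>, the unit of convolution.\<close>

lemma char_h_times: "char_h i * char_h j = (\<Sum>k=0..min i j. char_h (i + j - 2 * k))"
proof -
  have "char_h i * char_h j = (h i \<otimes> h j) \<odot> ht 0"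
    unfolding ch_mult_act by (simp add: ch_act_conv_times)
  then show ?thesis
    by (simp add: ch_act_conv_times ch_mult_def frag_extend_sum o_def)
qed

lemma char_h_times_in_K: "char_h i * char_h j \<in> K"
  unfolding char_h_times by (intro K_sum char_h_in_K)

lemma K_times: "f \<in> K \<Longrightarrow> g \<in> K \<Longrightarrow> f * g \<in> K"
proof (induction rule: K.induct)
  case zero
  show ?case by (simp add: K.zero)
next
  case (add_ht f d)
  have "ht (int d) * g \<in> K"
    using \<open>g \<in> K\<close>
  proof (induction rule: K.induct)
    case (add_ht g e)
    then show ?case
      using K.add_ht [of _ "d + e"] by (simp add: distrib_left mult_single)
  qed (simp_all add: K.zero distrib_left K_add ht_char_h_in_K)
  with add_ht show ?case
    by (simp add: distrib_right K_add)
next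
  case (add_char f n)
  have "char_h n * g \<in> K"
    using \<open>g \<in> K\<close>
  proof (induction rule: K.induct)
    case (add_ht g e)
    then show ?case
      using ht_char_h_in_K [of e n] by (simp add: distrib_left K_add mult.commute)
  qed (simp_all add: K.zero distrib_left K_add char_h_times_in_K)
  with add_char show ?case
    by (simp add: distrib_right K_add)
qed

lemma char_L_ht: "char_L (ht (int d)) = char_h d"
  by (simp add: L_def)

text \<open>Shifted monomials become irreducible characters; a summand \<open>char_h n\<close> is
  itself a value of \<open>char_L\<close>, so it can be pulled out, leaving a product of two
  characters.\<close>

lemma char_L_in_K: "f \<in> K \<Longrightarrow> char_L (ht (int c) * f) \<in> K"
proof (induction rule: K.induct)
  case zero
  show ?case by (simp add: L_def K.zero)
next
  case (add_ht f d)
  have "char_L (ht (int c) * (ht (int d) + f)) = char_h (c + d) + char_L (ht (int c) * f)"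
    using char_L_ht [of "c + d"]
    by (simp add: distrib_left mult_single L_def frag_extend_add)
  with add_ht.IH show ?case
    by (simp add: K.add_char)
next
  case (add_char f n)
  have "char_L (ht (int c) * char_h n) = char_h n * char_h c"
    using char_L_times [of "ht (int n)" "ht (int c)"] by (simp add: char_L_ht mult.commute)
  then have "char_L (ht (int c) * (char_h n + f)) = char_h n * char_h c + char_L (ht (int c) * f)"
    by (simp add: distrib_left L_def frag_extend_add)
  with add_char.IH show ?case
    by (simp add: K_add char_h_times_in_K)
qed

section \<open>From the semiring \<open>K\<close> to the multisets in \<open>R c\<close>\<close>

lemma R_empty: "{#} \<in> R c"
  unfolding R_def by (rule CollectI, rule exI [of _ 0], rule exI [of _ 0]) simp

lemma R_add_mset:
  assumes "M \<in> R c" "a \<ge> c"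
  shows "add_mset a M \<in> R c"
proof -
  from assms obtain k1 k2 :: nat and m n where
    M: "M = (\<Sum>i=1..k1. {# m i #}) + (\<Sum>i=1..k2. step2 (c - n i) (c + n i))"
    and mn: "\<forall>i\<in>{1..k1}. m i \<ge> c" "\<forall>i\<in>{1..k2}. n i \<ge> 1"
    unfolding R_def by blast
  let ?m = "m(Suc k1 := a)"
  have "(\<Sum>i=1..Suc k1. {# ?m i #}) = (\<Sum>i=1..k1. {# m i #}) + {#a#}"
    by simp
  then have "add_mset a M = (\<Sum>i=1..Suc k1. {# ?m i #}) + (\<Sum>i=1..k2. step2 (c - n i) (c + n i))"
    using M by simp
  moreover have "\<forall>i\<in>{1..Suc k1}. ?m i \<ge> c"
    using mn assms by auto
  ultimately show ?thesis
    unfolding R_def using mn by blast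
qed

lemma R_add_step2:
  assumes "M \<in> R c" "a \<ge> 1"
  shows "step2 (c - a) (c + a) + M \<in> R c"
proof -
  from assms obtain k1 k2 :: nat and m n where
    M: "M = (\<Sum>i=1..k1. {# m i #}) + (\<Sum>i=1..k2. step2 (c - n i) (c + n i))"
    and mn: "\<forall>i\<in>{1..k1}. m i \<ge> c" "\<forall>i\<in>{1..k2}. n i \<ge> 1"
    unfolding R_def by blast
  let ?n = "n(Suc k2 := a)"
  have "(\<Sum>i=1..Suc k2. step2 (c - ?n i) (c + ?n i))
      = (\<Sum>i=1..k2. step2 (c - n i) (c + n i)) + step2 (c - a) (c + a)"
    by simp
  then have "step2 (c - a) (c + a) + M
      = (\<Sum>i=1..k1. {# m i #}) + (\<Sum>i=1..Suc k2. step2 (c - ?n i) (c + ?n i))"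
    using M by (simp only: ac_simps)
  moreover have "\<forall>i\<in>{1..Suc k2}. ?n i \<ge> 1"
    using mn assms by auto
  ultimately show ?thesis
    unfolding R_def using mn by blast
qed

lemma K_imp_R: "f \<in> K \<Longrightarrow> \<exists>M\<in>R c. ht c * f = ht_mset M"
proof (induction rule: K.induct)
  case zero
  then show ?case
    using R_empty by force
next
  case (add_ht f d)
  then obtain M where "M \<in> R c" "ht c * f = ht_mset M"
    by blast
  then show ?case
    by (intro bexI [of _ "add_mset (c + int d) M"]) (simp_all add: distrib_left mult_single R_add_mset)
next
  case (add_char f n)
  then obtain M where M: "M \<in> R c" "ht c * f = ht_mset M"
    by blast
  show ?case
  \<comment> \<open>Intervals in \<open>R c\<close> have radius at least 1, so the trivial character
    is recorded as the singleton at \<open>c\<close>.\<close>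
  proof (cases "n = 0")
    case True
    with M show ?thesis
      by (intro bexI [of _ "add_mset c M"]) (simp_all add: distrib_left char_h_0 R_add_mset)
  next
    case False
    with M show ?thesis
      by (intro bexI [of _ "step2 (c - int n) (c + int n) + M"])
        (simp_all add: distrib_left ht_mset_step2 R_add_step2)
  qed
qed

text \<open>Squaring doubles the exponent of the shift, while the factor
  \<open>char_L (e0 n)\<close> lies in \<open>K\<close> and adds no shift. The first two equations
  are carried along because \<open>e_Suc\<close> assumes them.\<close>

lemma e_in_shifted_K:
  "e1 n = ht (- 1) * e0 n \<and> em1 n = e1 n \<and> (\<exists>f\<in>K. e0 n = ht (2 ^ (n + 1)) * f)"
proof (induction n)
  case 0
  have "e0 0 = ht (2 ^ (0 + 1)) * ht (int 0)"
    by simp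
  then have "\<exists>f\<in>K. e0 0 = ht (2 ^ (0 + 1)) * f"
    using ht_in_K by blast
  then show ?case
    by (simp add: mult_single)
next
  case (Suc n)
  then obtain f where f: "f \<in> K" "e0 n = ht (2 ^ (n + 1)) * f"
    by blast
  have "e0 (Suc n) = char_L (e0 n) * (e0 n * e0 n)"
    using Suc e_Suc by blast
  also have "e0 n * e0 n = ht (2 ^ (n + 1)) * ht (2 ^ (n + 1)) * (f * f)"
    by (simp only: f mult_ac)
  also have "ht (2 ^ (n + 1)) * ht (2 ^ (n + 1)) = ht (2 ^ (Suc n + 1))"
    by (simp add: mult_single)
  finally have "e0 (Suc n) = ht (2 ^ (Suc n + 1)) * (char_L (e0 n) * (f * f))"
    by (simp only: mult_ac)
  moreover have "char_L (e0 n) \<in> K"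
    using char_L_in_K [of f "2 ^ (n + 1)"] f by simp
  then have "char_L (e0 n) * (f * f) \<in> K"
    using f by (intro K_times)
  ultimately have "\<exists>f\<in>K. e0 (Suc n) = ht (2 ^ (Suc n + 1)) * f"
    by blast
  with Suc e_Suc(2,3) [of n] show ?case
    by blast
qed

theorem theorem2:
  fixes n :: nat
  shows "e1 n = S (-1) (e0 n)
    \<and> em1 n = e1 n
    \<and> (\<exists>M. M \<in> R (2 ^ (n + 1)) \<and> e0 n = ht_mset M
           \<and> e0 (n + 1) = L (e0 n) \<odot> ht_mset (M \<oplus> M))"
proof -
  obtain M where "M \<in> R (2 ^ (n + 1))" "e0 n = ht_mset M"
    using e_in_shifted_K [of n] K_imp_R by metis
  moreover from this have "e0 (n + 1) = L (e0 n) \<odot> ht_mset (M \<oplus> M)"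
    using e_Suc(1) [of n] e_in_shifted_K [of n] by (simp add: ch_act_conv_times ht_mset_mset_sum)
  ultimately show ?thesis
    using e_in_shifted_K [of n] unfolding S_conv_times by blast
qed

end
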